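(* Let $X$ be a non-empty set, $I\subseteq \mathbb{R}$ an interval and $F:I\to 2^X$ a multifunction satisfying the following conditions (in two parallel versions: a "sequential" version, and a version obtained by using the words in parentheses throughout): (i) there exist $\lambda_0\in I$, with $F(\lambda_0)\neq\emptyset$, and a topology on $F(\lambda_0)$ such that $F(\lambda_0)$ is sequentially compact (resp. compact); (ii) the set $\{\lambda\in I : F(\lambda)\cap F(\lambda_0)\text{ is sequentially closed (resp. closed) in }F(\lambda_0)\}$ is dense in $I$; (iii) for each $x\in X$, the set $I\setminus F^{-}(x)=\{\lambda\in I: x\notin F(\lambda)\}$ is an interval which is open in $I$. Then there exists a compact interval $[a^*,b^*]\subseteq I$ such that at least one of the following holds: (A) $(F(a^* )\cap F(\lambda_0))\setminus F((a^*,b^* ))\neq\emptyset$ and the restriction $F_{|(a^*,b^* )}$ is non-decreasing with respect to the inclusion; (B) $(F(b^* )\cap F(\lambda_0))\setminus F((a^*,b^* ))\neq\emptyset$ and the restriction $F_{|(a^*,b^* )}$ is non-increasing with respect to the inclusion. In particular, if $\lambda_0=\inf I$ then there exists such an interval for which (A) holds, and if $\lambda_0=\sup I$ then there exists such an interval for which (B) holds.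
   Context: "Interval" means a non-empty connected subset of $\mathbb{R}$ with more than one point (so in particular $a^*<b^*$). $2^X$ is the set of all subsets of $X$ (values of a multifunction may be empty). For $F:I\to 2^X$, $A\subseteq I$ and $B\subseteq X$: $F(A)=\bigcup_{\lambda\in A}F(\lambda)$, $F^{-}(B)=\{\lambda\in I: F(\lambda)\cap B\neq\emptyset\}$, and $F^-(x)=F^-(\{x\})$. $F$ is non-decreasing (resp. non-increasing) with respect to the inclusion on an interval if $F(\lambda)\subseteq F(\mu)$ (resp. $F(\mu)\subseteq F(\lambda)$) for all $\lambda<\mu$ in that interval. $(a^*,b^* )$ denotes the open interval. Compactness does not include the Hausdorff property. *)

theory Defs
  imports "HOL-Analysis.Analysis"
begin

(* Unlike is_interval, this excludes the empty set and singletons. *)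
definition nondegenerate_interval :: "real set \<Rightarrow> bool" where
  "nondegenerate_interval J \<longleftrightarrow> connected J \<and> (\<exists>x\<in>J. \<exists>y\<in>J. x \<noteq> y)"

(* The set F^-(B) for a multifunction F with domain I. *)
definition lower_preimage :: "real set \<Rightarrow> (real \<Rightarrow> 'a set) \<Rightarrow> 'a set \<Rightarrow> real set" where
  "lower_preimage I F B = {t \<in> I. F t \<inter> B \<noteq> {}}"

(* Counterpart of seq_compact for abstract topologies; limitin forces l \<in> topspace T.
   Limits need not be unique. *)
definition seq_compact_space :: "'a topology \<Rightarrow> bool" where
  "seq_compact_space T \<longleftrightarrow>
     (\<forall>\<sigma>::nat \<Rightarrow> 'a. range \<sigma> \<subseteq> topspace T \<longrightarrow>
        (\<exists>l r. strict_mono r \<and> limitin T (\<sigma> \<circ> r) l sequentially))"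

definition seq_closedin :: "'a topology \<Rightarrow> 'a set \<Rightarrow> bool" where
  "seq_closedin T C \<longleftrightarrow> C \<subseteq> topspace T \<and>
     (\<forall>(\<sigma>::nat \<Rightarrow> 'a) l. range \<sigma> \<subseteq> C \<and> limitin T \<sigma> l sequentially \<longrightarrow> l \<in> C)"

end

theory Submission
  imports Defs
begin

text \<open>For \<open>x \<in> F t\<^sub>0\<close> the set \<open>J x = {t \<in> I. x \<notin> F t}\<close> is an interval missing \<open>t\<^sub>0\<close>, so it lies on one
  side of \<open>t\<^sub>0\<close>. If it lies to the right for some \<open>x\<close>, then by compactness and density the left endpoint
  of \<open>J x\<close> attains its maximum \<open>a\<close> over all such \<open>x\<close>. No \<open>J y\<close> has its left endpoint beyond \<open>a\<close> (for
  \<open>y \<notin> F t\<^sub>0\<close> the interval \<open>J y\<close> contains \<open>t\<^sub>0\<close>), which says that \<open>F\<close> is non-decreasing to the right of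
  \<open>a\<close>. This gives (A); the case of \<open>J x\<close> to the left gives (B) by reflection.\<close>

section \<open>Common points of closed sets indexed by reals\<close>

text \<open>Sequential compactness applies to sequences only, while the closed sets are indexed by
  reals. Sets of reals have countable cofinality, so a sequence can stand in for the index set: it
  grows beyond every \<open>n\<close>, stays at an attained supremum, or approaches an unattained
  one.\<close>

lemma ex_cofinal_sequence:
  fixes D :: "real set"
  assumes "D \<noteq> {}"
  shows "\<exists>f::nat \<Rightarrow> real. range f \<subseteq> D \<and> (\<forall>d\<in>D. \<forall>\<^sub>F n in sequentially. d \<le> f n)"
proof (cases "bdd_above D")
  case False
  then have "\<exists>y\<in>D. real n < y" for n
    unfolding bdd_above_def by (meson not_le)
  then obtain f where f: "\<And>n. f n \<in> D" "\<And>n. real n < f n" by metis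
  have "\<forall>\<^sub>F n in sequentially. d \<le> f n" for d
    using eventually_ge_at_top[of "nat \<lceil>d\<rceil>"]
  proof eventually_elim
    case (elim n)
    then show ?case using f(2)[of n] by linarith
  qed
  with f show ?thesis by blast
next
  case bdd: True
  show ?thesis
  proof (cases "Sup D \<in> D")
    case True
    then show ?thesis
      using bdd by (intro exI[of _ "\<lambda>_. Sup D"]) (auto intro: cSup_upper)
  next
    case False
    have "\<exists>y\<in>D. Sup D - inverse (real (Suc n)) < y" for n
      using less_cSup_iff[OF assms bdd, of "Sup D - inverse (real (Suc n))"] by simp
    then obtain f where f: "\<And>n. f n \<in> D" "\<And>n. Sup D - inverse (real (Suc n)) < f n" by metis
    have "\<forall>\<^sub>F n in sequentially. d \<le> f n" if "d \<in> D" for d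
    proof -
      have "d < Sup D"
        using False that bdd by (metis cSup_upper order_le_less)
      then have "\<forall>\<^sub>F n in sequentially. inverse (real (Suc n)) < Sup D - d"
        using LIMSEQ_inverse_real_of_nat by (intro order_tendstoD) auto
      then show ?thesis
      proof eventually_elim
        case (elim n)
        then show ?case using f(2)[of n] by linarith
      qed
    qed
    with f show ?thesis by blast
  qed
qed

text \<open>The sets \<open>C t\<close> need not be nested. Instead, \<open>w t\<close> lies in all
  \<open>C s\<close> with \<open>s \<le> t\<close>, so finitely many of them share the value of
  \<open>w\<close> at their largest index, and a subsequential limit of \<open>w\<close> along a
  cofinal sequence lies in all of them.\<close>

lemma ex_common_point:
  fixes D :: "real set" and C :: "real \<Rightarrow> 'a set"
  assumes cpt: "(seq_compact_space T \<and> (\<forall>t\<in>D. seq_closedin T (C t)))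
             \<or> (compact_space T \<and> (\<forall>t\<in>D. closedin T (C t)))"
    and ne: "topspace T \<noteq> {}"
    and w: "\<And>s t. s \<in> D \<Longrightarrow> t \<in> D \<Longrightarrow> s \<le> t \<Longrightarrow> w t \<in> C s"
  shows "\<exists>x\<in>topspace T. \<forall>t\<in>D. x \<in> C t"
proof (cases "D = {}")
  case True
  then show ?thesis using ne by blast
next
  case False
  from cpt show ?thesis
  proof (elim disjE conjE)
    assume "seq_compact_space T" and clo: "\<forall>t\<in>D. seq_closedin T (C t)"
    obtain f :: "nat \<Rightarrow> real" where f: "range f \<subseteq> D" "\<And>d. d \<in> D \<Longrightarrow> \<forall>\<^sub>F n in sequentially. d \<le> f n"
      using ex_cofinal_sequence[OF False] by blast
    have "range (w \<circ> f) \<subseteq> topspace T"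
    proof clarify
      fix n
      have "f n \<in> D" using f(1) by blast
      with w clo show "(w \<circ> f) n \<in> topspace T" unfolding seq_closedin_def by fastforce
    qed
    then obtain l r where r: "strict_mono (r :: nat \<Rightarrow> nat)"
      and l: "limitin T (w \<circ> f \<circ> r) l sequentially"
      using \<open>seq_compact_space T\<close> unfolding seq_compact_space_def by blast
    have "l \<in> C t" if t: "t \<in> D" for t
    proof -
      obtain N where N: "\<And>n. n \<ge> N \<Longrightarrow> t \<le> f n"
        using f(2)[OF t] unfolding eventually_sequentially by blast
      \<comment> \<open>Sequential closedness wants every term in \<open>C t\<close>, hence the
        shift by \<open>N\<close>; as \<open>r n \<ge> n\<close>, all indices used are then at least
        \<open>N\<close>.\<close>
      let ?s = "\<lambda>n. (w \<circ> f \<circ> r) (n + N)"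
      have "?s n \<in> C t" for n
      proof -
        have "N \<le> r (n + N)" using seq_suble[OF r, of "n + N"] by linarith
        then show ?thesis using w[OF t, of "f (r (n + N))"] f(1) N by auto
      qed
      moreover have "limitin T ?s l sequentially"
        by (rule limitin_sequentially_offset[OF l])
      ultimately have "range ?s \<subseteq> C t \<and> limitin T ?s l sequentially" by blast
      moreover have "seq_closedin T (C t)" using clo t by simp
      ultimately show ?thesis unfolding seq_closedin_def by metis
    qed
    moreover have "l \<in> topspace T" using l by (rule limitin_topspace)
    ultimately show ?thesis by blast
  next
    assume T: "compact_space T" and clo: "\<forall>t\<in>D. closedin T (C t)"
    have "\<Inter>(C ` D) \<noteq> {}"
    proof -
      have fip: "\<Inter>\<F> \<noteq> {}" if sub: "finite \<F>" "\<F> \<subseteq> C ` D" for \<F>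
      proof (cases "\<F> = {}")
        case False
        obtain E where E: "E \<subseteq> D" "finite E" "\<F> = C ` E"
          using finite_subset_image[OF sub] by blast
        with False have "E \<noteq> {}" by blast
        have "w (Max E) \<in> C s" if "s \<in> E" for s
          using w[of s "Max E"] that E(1) Max_in[OF E(2) \<open>E \<noteq> {}\<close>] Max_ge[OF E(2) that] by blast
        with E show ?thesis by blast
      qed simp
      have "\<forall>S\<in>C ` D. closedin T S" using clo by simp
      with T fip show ?thesis unfolding compact_space_fip by blast
    qed
    then obtain x where "\<forall>t\<in>D. x \<in> C t" by blast
    moreover have "x \<in> topspace T"
      using False clo calculation by (meson all_not_in_conv closedin_subset subsetD)
    ultimately show ?thesis by blast
  qed
qed

lemma openin_meets_dense:
  assumes "I \<subseteq> closure D" "D \<subseteq> I" "openin (top_of_set I) S" "S \<noteq> {}"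
  shows "\<exists>t\<in>D. t \<in> S"
proof -
  obtain U where U: "open U" "S = I \<inter> U"
    using assms(3) unfolding openin_open by blast
  then have "U \<inter> closure D \<noteq> {}" using assms(1,4) by blast
  with U(1) have "U \<inter> D \<noteq> {}" by (simp add: open_Int_closure_eq_empty)
  with U(2) assms(2) show ?thesis by blast
qed

section \<open>The right-hand case: maximality and monotonicity\<close>

text \<open>Bundling the hypotheses allows a second instantiation with the reflected multifunction
  \<open>\<lambda>t. F (- t)\<close>, which yields the left-hand case.\<close>

locale interval_multifunction =
  fixes I :: "real set" and F :: "real \<Rightarrow> 'a set" and t\<^sub>0 :: real and T :: "'a topology"
    and J :: "'a \<Rightarrow> real set" and X :: "'a set"
  defines "J \<equiv> \<lambda>x. {t \<in> I. x \<notin> F t}"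
  assumes interval_I: "nondegenerate_interval I"
    and t0: "t\<^sub>0 \<in> I" "topspace T = F t\<^sub>0"
    and F_sub: "\<And>t. t \<in> I \<Longrightarrow> F t \<subseteq> X"
    and compactness: "(seq_compact_space T \<and> I \<subseteq> closure {t \<in> I. seq_closedin T (F t \<inter> F t\<^sub>0)})
       \<or> (compact_space T \<and> I \<subseteq> closure {t \<in> I. closedin T (F t \<inter> F t\<^sub>0)})"
    and interval_J: "\<And>x. x \<in> X \<Longrightarrow> nondegenerate_interval (J x)"
    and open_J: "\<And>x. x \<in> X \<Longrightarrow> openin (top_of_set I) (J x)"
begin

lemma between_I: "\<lbrakk>p \<in> I; q \<in> I; p \<le> r; r \<le> q\<rbrakk> \<Longrightarrow> r \<in> I"
  using interval_I unfolding nondegenerate_interval_def by (metis connectedD_interval)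

lemma between_J: "\<lbrakk>x \<in> X; p \<in> J x; q \<in> J x; p \<le> r; r \<le> q\<rbrakk> \<Longrightarrow> r \<in> J x"
  using interval_J unfolding nondegenerate_interval_def by (metis connectedD_interval)

lemma one_sided:
  assumes "x \<in> F t\<^sub>0"
  shows "J x \<subseteq> {t\<^sub>0<..} \<or> J x \<subseteq> {..<t\<^sub>0}"
proof (rule ccontr)
  assume "\<not> ?thesis"
  then obtain p q where "p \<in> J x" "p \<le> t\<^sub>0" "q \<in> J x" "t\<^sub>0 \<le> q"
    by (metis greaterThan_iff lessThan_iff not_less subsetI)
  moreover have "x \<in> X" using F_sub t0(1) assms by blast
  ultimately have "t\<^sub>0 \<in> J x" using between_J by blast
  then show False using assms unfolding J_def by simp
qed

text \<open>Since \<open>q\<close> may be taken arbitrarily close to the left end of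
  \<open>J x\<close>, the last property says that the left end of \<open>J x\<close> is maximal,
  without mentioning infima.\<close>

lemma ex_maximal:
  assumes x0: "x\<^sub>0 \<in> F t\<^sub>0" "J x\<^sub>0 \<subseteq> {t\<^sub>0<..}"
  obtains x where "x \<in> F t\<^sub>0" "J x \<subseteq> {t\<^sub>0<..}"
    and "\<And>y p q. \<lbrakk>y \<in> F t\<^sub>0; J y \<subseteq> {t\<^sub>0<..}; p \<in> J x; q \<in> J x; p < q\<rbrakk> \<Longrightarrow> \<exists>m\<in>J y. m < q"
proof -
  \<comment> \<open>\<open>D\<close> is the dense index set of whichever version of compactness
    holds; from here on both versions run together.\<close>
  obtain D where D: "D \<subseteq> I" "I \<subseteq> closure D"
    and cpt: "(seq_compact_space T \<and> (\<forall>t\<in>D. seq_closedin T (F t \<inter> F t\<^sub>0)))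
           \<or> (compact_space T \<and> (\<forall>t\<in>D. closedin T (F t \<inter> F t\<^sub>0)))"
    using compactness
  proof (elim disjE conjE)
    assume "seq_compact_space T" "I \<subseteq> closure {t \<in> I. seq_closedin T (F t \<inter> F t\<^sub>0)}"
    then show thesis by (intro that[of "{t \<in> I. seq_closedin T (F t \<inter> F t\<^sub>0)}"]) auto
  next
    assume "compact_space T" "I \<subseteq> closure {t \<in> I. closedin T (F t \<inter> F t\<^sub>0)}"
    then show thesis by (intro that[of "{t \<in> I. closedin T (F t \<inter> F t\<^sub>0)}"]) auto
  qed
  \<comment> \<open>These are the indices in \<open>D\<close> lying to the left of some admissible
    \<open>J x\<close>, and \<open>w t\<close> is such an \<open>x\<close>. For
    \<open>s \<le> t\<close> the interval \<open>J (w t)\<close> misses \<open>s\<close>, so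
    \<open>w t \<in> F s\<close>, as \<open>ex_common_point\<close> requires.\<close>
  define D' where "D' = {t \<in> D. \<exists>x\<in>F t\<^sub>0. J x \<subseteq> {t\<^sub>0<..} \<and> J x \<subseteq> {t<..}}"
  then have "\<forall>t\<in>D'. \<exists>x. x \<in> F t\<^sub>0 \<and> J x \<subseteq> {t<..}" by blast
  then obtain w where w: "\<And>t. t \<in> D' \<Longrightarrow> w t \<in> F t\<^sub>0 \<and> J (w t) \<subseteq> {t<..}" by metis
  have "\<exists>x\<in>topspace T. \<forall>t\<in>D'. x \<in> F t \<inter> F t\<^sub>0"
  proof (rule ex_common_point[where w = w])
    show "(seq_compact_space T \<and> (\<forall>t\<in>D'. seq_closedin T (F t \<inter> F t\<^sub>0)))
        \<or> (compact_space T \<and> (\<forall>t\<in>D'. closedin T (F t \<inter> F t\<^sub>0)))"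
      using cpt unfolding D'_def by blast
    show "topspace T \<noteq> {}" using x0 t0 by blast
    fix s t assume st: "s \<in> D'" "t \<in> D'" "s \<le> t"
    then have "s \<in> I" using D(1) unfolding D'_def by blast
    moreover have "s \<notin> J (w t)" using w st by force
    ultimately show "w t \<in> F s \<inter> F t\<^sub>0" using w st unfolding J_def by blast
  qed
  then obtain x where x: "x \<in> F t\<^sub>0" "\<And>t. t \<in> D' \<Longrightarrow> x \<in> F t" using t0 by blast
  then have xX: "x \<in> X" using F_sub t0(1) by blast
  \<comment> \<open>If \<open>J y\<close> began at \<open>q\<close> or later, density would give
    some \<open>t \<in> D\<close> in \<open>J x\<close> with \<open>t < q\<close>. Then
    \<open>y\<close> puts \<open>t\<close> into \<open>D'\<close>, so \<open>x \<in> F t\<close>,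
    contradicting \<open>t \<in> J x\<close>. Here \<open>q\<close> need not lie in
    \<open>J x\<close>.\<close>
  have bound: "\<exists>m\<in>J y. m < q"
    if y: "y \<in> F t\<^sub>0" "J y \<subseteq> {t\<^sub>0<..}" and p: "p \<in> J x" "p < q" for y p q
  proof (rule ccontr)
    assume "\<not> (\<exists>m\<in>J y. m < q)"
    then have "J y \<subseteq> {q..}" by force
    have "openin (top_of_set I) (J x \<inter> {..<q})"
      using open_J[OF xX] unfolding openin_open by (metis Int_assoc open_Int open_lessThan)
    then obtain t where t: "t \<in> D" "t \<in> J x" "t < q"
      using openin_meets_dense[OF D(2,1)] p by blast
    then have "t \<in> D'" using y \<open>J y \<subseteq> {q..}\<close> unfolding D'_def by force
    with t x(2) show False unfolding J_def by blast
  qed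
  \<comment> \<open>The common point \<open>x\<close> might a priori have its interval on the left.
    Then \<open>bound\<close> with \<open>q = t\<^sub>0\<close> would give a point of
    \<open>J x\<^sub>0\<close> to the left of \<open>t\<^sub>0\<close>.\<close>
  have "J x \<subseteq> {t\<^sub>0<..}"
  proof (rule ccontr)
    assume "\<not> ?thesis"
    then have "J x \<subseteq> {..<t\<^sub>0}" using one_sided x(1) by blast
    moreover obtain p where "p \<in> J x"
      using interval_J[OF xX] unfolding nondegenerate_interval_def by blast
    ultimately show False using bound[OF x0, of p t\<^sub>0] x0(2) by force
  qed
  then show thesis using that x(1) bound by blast
qed

lemma ex_mono_on:
  assumes "x\<^sub>0 \<in> F t\<^sub>0" "J x\<^sub>0 \<subseteq> {t\<^sub>0<..}"
  shows "\<exists>a b. a < b \<and> {a..b} \<subseteq> I \<and> (F a \<inter> F t\<^sub>0) - \<Union> (F ` {a<..<b}) \<noteq> {} \<and> mono_on {a<..<b} F"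
proof -
  obtain x where x: "x \<in> F t\<^sub>0" "J x \<subseteq> {t\<^sub>0<..}"
    and bound: "\<And>y p q. \<lbrakk>y \<in> F t\<^sub>0; J y \<subseteq> {t\<^sub>0<..}; p \<in> J x; q \<in> J x; p < q\<rbrakk> \<Longrightarrow> \<exists>m\<in>J y. m < q"
    using ex_maximal[OF assms] by blast
  have xX: "x \<in> X" using x(1) F_sub t0(1) by blast
  have JI: "J y \<subseteq> I" for y unfolding J_def by blast
  \<comment> \<open>The left end of the maximal interval serves as \<open>a\<close>, and any
    non-minimal point of \<open>J x\<close> as \<open>b\<close>: \<open>x\<close> is missing from
    \<open>F\<close> throughout the open interval, but belongs to \<open>F a\<close> because the
    relatively open \<open>J x\<close> cannot contain its infimum.\<close>
  define a where "a = Inf (J x)"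
  obtain p b where pb: "p \<in> J x" "b \<in> J x" "p < b"
    using interval_J[OF xX] unfolding nondegenerate_interval_def by (metis linorder_neqE)
  have bdd: "bdd_below (J x)" using x(2) by (meson bdd_below_Ioi bdd_below_mono)
  have "a \<le> p" unfolding a_def using bdd pb(1) by (rule cInf_lower[rotated])
  have "t\<^sub>0 \<le> a" unfolding a_def using pb(1) x(2) by (intro cInf_greatest) force+
  have "a < b" using \<open>a \<le> p\<close> pb(3) by simp
  have "a \<in> I" using between_I[OF t0(1), of b a] JI pb \<open>t\<^sub>0 \<le> a\<close> \<open>a < b\<close> by force
  have below: "\<exists>p\<in>J x. p < r" if "a < r" for r
    using that pb(1) bdd unfolding a_def by (metis cInf_less_iff empty_iff)
  have "a \<notin> J x"
  proof
    assume "a \<in> J x"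
    then obtain U where U: "open U" "J x = I \<inter> U" "a \<in> U"
      using open_J[OF xX] unfolding openin_open by blast
    then obtain e where e: "e > 0" "\<And>z. dist z a < e \<Longrightarrow> z \<in> U"
      unfolding open_dist by blast
    have "t\<^sub>0 < a" using \<open>a \<in> J x\<close> x(2) by auto
    \<comment> \<open>\<open>J x\<close> is open only relative to \<open>I\<close>; the maximum with
      \<open>t\<^sub>0\<close> keeps this point, slightly to the left of \<open>a\<close>, inside
      \<open>I\<close>.\<close>
    let ?z = "max t\<^sub>0 (a - e / 2)"
    have "?z \<in> I" using between_I[OF t0(1) \<open>a \<in> I\<close>] e \<open>t\<^sub>0 < a\<close> by force
    moreover have "?z \<in> U" using e \<open>t\<^sub>0 < a\<close> by (intro e(2)) (auto simp: dist_real_def)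
    ultimately have "a \<le> ?z" unfolding a_def using U(2) bdd by (intro cInf_lower) auto
    then show False using e(1) \<open>t\<^sub>0 < a\<close> by auto
  qed
  then have "x \<in> F a" using \<open>a \<in> I\<close> unfolding J_def by blast
  have sub: "{a<..<b} \<subseteq> J x"
  proof
    fix r assume "r \<in> {a<..<b}"
    then obtain q where "q \<in> J x" "q < r" "r < b" using below by auto
    then show "r \<in> J x" using between_J[OF xX _ pb(2)] by (meson less_imp_le)
  qed
  then have "x \<notin> \<Union> (F ` {a<..<b})" unfolding J_def by blast
  moreover have "{a..b} \<subseteq> I" using between_I[OF \<open>a \<in> I\<close>, of b] pb(2) JI by force
  moreover have "mono_on {a<..<b} F"
  proof (intro mono_onI subsetI, rule ccontr)
    fix r s y
    assume rs: "r \<in> {a<..<b}" "s \<in> {a<..<b}" "r \<le> s" and y: "y \<in> F r" "y \<notin> F s"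
    have "r \<in> I" "s \<in> I" using rs sub JI by blast+
    then have s: "s \<in> J y" "r \<notin> J y" and yX: "y \<in> X" using y F_sub unfolding J_def by blast+
    \<comment> \<open>Such an \<open>m\<close> together with \<open>s \<in> J y\<close> forces
      \<open>r \<in> J y\<close> by convexity, which is absurd. It comes from maximality if
      \<open>y \<in> F t\<^sub>0\<close>; otherwise \<open>t\<^sub>0\<close> itself serves.\<close>
    have "\<exists>m\<in>J y. m \<le> r"
    proof (cases "y \<in> F t\<^sub>0")
      case True
      have "t\<^sub>0 < s" using \<open>t\<^sub>0 \<le> a\<close> rs by simp
      then have "J y \<subseteq> {t\<^sub>0<..}" using one_sided[OF True] s by force
      moreover obtain p where "p \<in> J x" "p < r" using below rs by auto
      ultimately show ?thesis using bound[OF True, of p r] rs(1) sub by (meson less_imp_le subsetD)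
    next
      case False
      then have "t\<^sub>0 \<in> J y" using t0(1) unfolding J_def by blast
      moreover have "t\<^sub>0 \<le> r" using \<open>t\<^sub>0 \<le> a\<close> rs(1) by simp
      ultimately show ?thesis by blast
    qed
    then show False using between_J[OF yX] s rs(3) by blast
  qed
  ultimately show ?thesis using \<open>a < b\<close> \<open>x \<in> F a\<close> x(1) by blast
qed

end

section \<open>The left-hand case by reflection at the origin\<close>

lemma nondegenerate_interval_uminus:
  assumes "nondegenerate_interval S"
  shows "nondegenerate_interval (uminus ` S)"
proof -
  have "connected (uminus ` S)"
    using assms unfolding nondegenerate_interval_def
    by (intro connected_continuous_image continuous_intros) auto
  then show ?thesis using assms unfolding nondegenerate_interval_def by force
qed

lemma closure_uminus_subset:
  fixes S :: "real set"
  assumes "S \<subseteq> closure {t \<in> S. P t}"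
  shows "uminus ` S \<subseteq> closure {t \<in> uminus ` S. P (- t)}"
proof -
  have "uminus ` {t \<in> S. P t} \<subseteq> {t \<in> uminus ` S. P (- t)}" by auto
  also note closure_subset
  finally have "uminus ` closure {t \<in> S. P t} \<subseteq> closure {t \<in> uminus ` S. P (- t)}"
    by (intro image_closure_subset continuous_intros) auto
  then show ?thesis using assms by blast
qed

lemma openin_uminus:
  fixes S :: "real set"
  assumes "openin (top_of_set S) A"
  shows "openin (top_of_set (uminus ` S)) (uminus ` A)"
proof -
  obtain U where U: "open U" "A = S \<inter> U"
    using assms unfolding openin_open by blast
  have "uminus ` A = uminus ` S \<inter> uminus ` U" using U(2) by force
  then show ?thesis using open_negations[OF U(1)] unfolding openin_open by blast
qed

lemma (in interval_multifunction) interval_multifunction_uminus: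
  "interval_multifunction (uminus ` I) (\<lambda>t. F (- t)) (- t\<^sub>0) T X"
proof -
  have J': "{t \<in> uminus ` I. x \<notin> F (- t)} = uminus ` J x" for x
    unfolding J_def by force
  show ?thesis
  proof
    show "nondegenerate_interval (uminus ` I)"
      by (rule nondegenerate_interval_uminus[OF interval_I])
    show "- t\<^sub>0 \<in> uminus ` I" "topspace T = F (- (- t\<^sub>0))" using t0 by auto
    show "F (- t) \<subseteq> X" if "t \<in> uminus ` I" for t using F_sub that by fastforce
    show "(seq_compact_space T \<and>
           uminus ` I \<subseteq> closure {t \<in> uminus ` I. seq_closedin T (F (- t) \<inter> F (- (- t\<^sub>0)))})
        \<or> (compact_space T \<and>
           uminus ` I \<subseteq> closure {t \<in> uminus ` I. closedin T (F (- t) \<inter> F (- (- t\<^sub>0)))})"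
      using compactness
        closure_uminus_subset[of I "\<lambda>t. seq_closedin T (F t \<inter> F t\<^sub>0)"]
        closure_uminus_subset[of I "\<lambda>t. closedin T (F t \<inter> F t\<^sub>0)"] by auto
    show "nondegenerate_interval {t \<in> uminus ` I. x \<notin> F (- t)}" if "x \<in> X" for x
      unfolding J' by (rule nondegenerate_interval_uminus[OF interval_J[OF that]])
    show "openin (top_of_set (uminus ` I)) {t \<in> uminus ` I. x \<notin> F (- t)}" if "x \<in> X" for x
      unfolding J' by (rule openin_uminus[OF open_J[OF that]])
  qed
qed

text \<open>Reflection moves \<open>J x\<^sub>0\<close> to the right of \<open>- t\<^sub>0\<close>.
  Reflecting the resulting \<open>{a..b}\<close> back to \<open>{- b..- a}\<close> exchanges the
  endpoints and reverses the monotonicity.\<close>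

lemma (in interval_multifunction) ex_antimono_on:
  assumes "x\<^sub>0 \<in> F t\<^sub>0" "J x\<^sub>0 \<subseteq> {..<t\<^sub>0}"
  shows "\<exists>a b. a < b \<and> {a..b} \<subseteq> I \<and> (F b \<inter> F t\<^sub>0) - \<Union> (F ` {a<..<b}) \<noteq> {} \<and> antimono_on {a<..<b} F"
proof -
  interpret R: interval_multifunction "uminus ` I" "\<lambda>t. F (- t)" "- t\<^sub>0" T
      "\<lambda>x. {t \<in> uminus ` I. x \<notin> F (- t)}" X
    by (rule interval_multifunction_uminus)
  have "{t \<in> uminus ` I. x\<^sub>0 \<notin> F (- t)} \<subseteq> {- t\<^sub>0<..}"
    using assms(2) unfolding J_def by auto
  moreover have "x\<^sub>0 \<in> F (- (- t\<^sub>0))" using assms(1) by simp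
  ultimately obtain a b where ab: "a < b" "{a..b} \<subseteq> uminus ` I"
    and ne: "(F (- a) \<inter> F t\<^sub>0) - \<Union> ((\<lambda>t. F (- t)) ` {a<..<b}) \<noteq> {}"
    and mono: "mono_on {a<..<b} (\<lambda>t. F (- t))"
    using R.ex_mono_on[of x\<^sub>0] unfolding minus_minus by metis
  have "(\<lambda>t. F (- t)) ` {a<..<b} = F ` {- b<..<- a}"
    by (simp flip: image_uminus_greaterThanLessThan add: image_image)
  moreover have "{- b..- a} \<subseteq> I"
    using image_mono[OF ab(2), of uminus] by (simp add: image_image)
  moreover have "antimono_on {- b<..<- a} F"
  proof (rule monotone_onI)
    fix r s assume "r \<in> {- b<..<- a}" "s \<in> {- b<..<- a}" "r \<le> s"
    then show "F s \<le> F r" using mono_onD[OF mono, of "- s" "- r"] by simp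
  qed
  ultimately show ?thesis using ab(1) ne by (intro exI[of _ "- b"] exI[of _ "- a"]) simp
qed

theorem theorem1:
  fixes X :: "'a set" and I :: "real set" and F :: "real \<Rightarrow> 'a set"
    and t\<^sub>0 :: real and T :: "'a topology"
  assumes "X \<noteq> {}"
    and "nondegenerate_interval I"
    and "\<And>t. t \<in> I \<Longrightarrow> F t \<subseteq> X"
    and "t\<^sub>0 \<in> I" and "F t\<^sub>0 \<noteq> {}" and "topspace T = F t\<^sub>0"
    and "(seq_compact_space T \<and> I \<subseteq> closure {t \<in> I. seq_closedin T (F t \<inter> F t\<^sub>0)})
       \<or> (compact_space T \<and> I \<subseteq> closure {t \<in> I. closedin T (F t \<inter> F t\<^sub>0)})"
    and "\<And>x. x \<in> X \<Longrightarrow> nondegenerate_interval (I - lower_preimage I F {x})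
                    \<and> openin (top_of_set I) (I - lower_preimage I F {x})"
  shows "(\<exists>a b. a < b \<and> {a..b} \<subseteq> I \<and>
            (((F a \<inter> F t\<^sub>0) - \<Union> (F ` {a<..<b}) \<noteq> {} \<and> mono_on {a<..<b} F) \<or>
             ((F b \<inter> F t\<^sub>0) - \<Union> (F ` {a<..<b}) \<noteq> {} \<and> antimono_on {a<..<b} F)))
       \<and> (bdd_below I \<and> t\<^sub>0 = Inf I \<longrightarrow>
            (\<exists>a b. a < b \<and> {a..b} \<subseteq> I \<and>
               (F a \<inter> F t\<^sub>0) - \<Union> (F ` {a<..<b}) \<noteq> {} \<and> mono_on {a<..<b} F))
       \<and> (bdd_above I \<and> t\<^sub>0 = Sup I \<longrightarrow>
            (\<exists>a b. a < b \<and> {a..b} \<subseteq> I \<and>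
               (F b \<inter> F t\<^sub>0) - \<Union> (F ` {a<..<b}) \<noteq> {} \<and> antimono_on {a<..<b} F))"
proof -
  have J: "I - lower_preimage I F {x} = {t \<in> I. x \<notin> F t}" for x
    unfolding lower_preimage_def by auto
  interpret interval_multifunction I F t\<^sub>0 T "\<lambda>x. {t \<in> I. x \<notin> F t}" X
    using assms(2-4,6-8) unfolding J by unfold_locales auto
  \<comment> \<open>One arbitrary point of \<open>F t\<^sub>0\<close> decides the alternative: the
    side on which its interval \<open>K\<close> lies.\<close>
  obtain x where x: "x \<in> F t\<^sub>0" using assms(5) by blast
  define K where "K = {t \<in> I. x \<notin> F t}"
  have "K \<noteq> {}"
    using x assms(3)[OF assms(4)] assms(8)[of x] unfolding J K_def nondegenerate_interval_def by blast
  note sides = one_sided[OF x, folded K_def]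
    and right = ex_mono_on[OF x, folded K_def] and left = ex_antimono_on[OF x, folded K_def]
  \<comment> \<open>Boundedness makes \<open>Inf I\<close> a genuine infimum. With
    \<open>t\<^sub>0\<close> at the left end of \<open>I\<close>, the non-empty \<open>K\<close> has
    no room on the left.\<close>
  have "K \<subseteq> {t\<^sub>0<..}" if "bdd_below I" "t\<^sub>0 = Inf I"
  proof -
    have "K \<subseteq> {t\<^sub>0..}" using that unfolding K_def by (auto intro: cInf_lower)
    with sides \<open>K \<noteq> {}\<close> show ?thesis by force
  qed
  moreover have "K \<subseteq> {..<t\<^sub>0}" if "bdd_above I" "t\<^sub>0 = Sup I"
  proof -
    have "K \<subseteq> {..t\<^sub>0}" using that unfolding K_def by (auto intro: cSup_upper)
    with sides \<open>K \<noteq> {}\<close> show ?thesis by force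
  qed
  ultimately show ?thesis using sides right left by meson
qed

end
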